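(* For each integer $m\ge 2$, $\mathsf{iTC}_m$ is a homotopy invariant of spaces: if $X$ and $Y$ are homotopy equivalent path-connected ANR spaces, then $\mathsf{iTC}_m(X)=\mathsf{iTC}_m(Y)$.
   Context: $I=[0,1]$. For a metric space $Z$ and $n\ge 1$, $\mathcal B_n(Z)$ is the space of probability measures on $Z$ whose support has at most $n$ points, written as finite formal convex combinations $\sum\lambda_z z$ with $\lambda_z>0$, $\sum\lambda_z=1$, equipped with the Lévy–Prokhorov metric; $\delta_z$ is the Dirac measure at $z$. $P(Z)$ is the space of continuous paths $I\to Z$ with the compact-open topology. Define $\Phi_n:\mathcal B_n(P(X))\to P(\mathcal B_n(X))$ by $\Phi_n(\sum\lambda_\alpha\alpha)(t)=\sum\lambda_\alpha\alpha(t)$. A path $f\in P(\mathcal B_n(X))$ is resolvable if $f=\Phi_n(\mu)$ for some $\mu\in\mathcal B_n(P(X))$; $RP(\mathcal B_n(X))\subset P(\mathcal B_n(X))$ is the subspace of resolvable paths. For $m\ge2$ let $t_i=(i-1)/(m-1)$, $1\le i\le m$. The $m$-th sequential intertwining topological complexity $\mathsf{iTC}_m(X)$ is the minimal integer $n\ge 0$ such that there is a continuous map $s_m:X^m\to RP(\mathcal B_{n+1}(X))$ with $s_m(x_1,\dots,x_m)(t_i)=\delta_{x_i}$ for all $1\le i\le m$ and all $(x_1,\dots,x_m)\in X^m$ (infinite if no such $n$ exists). *)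

theory Defs
  imports "HOL-Analysis.Analysis" "HOL-Probability.Probability_Mass_Function"
begin

section \<open>Absolute neighbourhood retracts\<close>

text \<open>
  A metrizable space is an ANR if every closed copy of it in a metrizable space \<open>Z\<close> is a retract of
  a neighbourhood. HOL cannot quantify over all types of points of \<open>Z\<close>; the type
  \<^typ>\<open>'a \<Rightarrow> real\<close> loses nothing. Indeed, for a bounded compatible metric \<open>d\<close> on \<open>X\<close>, the map
  \<open>x \<mapsto> d x\<close> embeds \<open>X\<close> as a closed subset of the convex hull of its image in the bounded functions
  with the sup metric (Kuratowski--Wojdyslawski), and a neighbourhood retract of a convex
  set in a normed space is an ANR without restriction (Dugundji).

  The constant \<open>ANR\<close> of \<open>HOL-Analysis.Retracts\<close> only considers closed copies in
  subsets of one fixed ambient space and is intended for Euclidean spaces.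
\<close>

definition ANR_space :: "'a topology \<Rightarrow> bool" where
  "ANR_space X \<longleftrightarrow> metrizable_space X \<and>
     (\<forall>(Z :: ('a \<Rightarrow> real) topology) A.
        metrizable_space Z \<and> closedin Z A \<and> X homeomorphic_space (subtopology Z A) \<longrightarrow>
        (\<exists>U. openin Z U \<and> A \<subseteq> U \<and> A retract_of_space (subtopology Z U)))"


section \<open>Compact-open topology and path spaces\<close>

text \<open>Continuous maps are represented by functions that are \<^const>\<open>undefined\<close> off the domain.\<close>

definition continuous_maps :: "'a topology \<Rightarrow> 'b topology \<Rightarrow> ('a \<Rightarrow> 'b) set" where
  "continuous_maps X Y = {f \<in> extensional (topspace X). continuous_map X Y f}"

definition compact_open_topology :: "'a topology \<Rightarrow> 'b topology \<Rightarrow> ('a \<Rightarrow> 'b) topology" where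
  "compact_open_topology X Y = topology_generated_by
     {{f \<in> continuous_maps X Y. f ` K \<subseteq> U} |K U. compactin X K \<and> openin Y U}"

lemma topspace_compact_open_topology [simp]:
  "topspace (compact_open_topology X Y) = continuous_maps X Y"
proof -
  have "continuous_maps X Y
      \<in> {{f \<in> continuous_maps X Y. f ` K \<subseteq> U} |K U. compactin X K \<and> openin Y U}"
    by (rule CollectI, rule exI[of _ "{}"], rule exI[of _ "topspace Y"]) simp
  then show ?thesis
    unfolding compact_open_topology_def topology_generated_by_topspace by blast
qed

abbreviation unit_interval :: "real topology" where
  "unit_interval \<equiv> top_of_set {0..1}"

definition path_space :: "'a topology \<Rightarrow> (real \<Rightarrow> 'a) topology" where
  "path_space Z = compact_open_topology unit_interval Z"

lemma topspace_path_space: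
  "topspace (path_space Z) = {f \<in> extensional {0..1}. pathin Z f}"
  by (simp add: path_space_def continuous_maps_def pathin_def)


section \<open>Finitely supported probability measures and the Levy--Prokhorov (LP) metric\<close>

text \<open>
  A formal convex combination \<open>\<Sum> \<lambda>\<^sub>z z\<close> with all \<open>\<lambda>\<^sub>z > 0\<close> is the \<^typ>\<open>'a pmf\<close> with mass
  \<open>\<lambda>\<^sub>z\<close> at \<open>z\<close>; its support is \<^const>\<open>set_pmf\<close>, and \<open>\<delta>\<^sub>z\<close> is \<^const>\<open>return_pmf\<close>.
\<close>

definition fin_measures :: "nat \<Rightarrow> 'a set \<Rightarrow> 'a pmf set" where
  "fin_measures n S = {\<mu>. finite (set_pmf \<mu>) \<and> card (set_pmf \<mu>) \<le> n \<and> set_pmf \<mu> \<subseteq> S}"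

definition borel_sets_of :: "'a metric \<Rightarrow> 'a set set" where
  "borel_sets_of X = sigma_sets (mspace X) {U. openin (mtopology_of X) U}"

definition enlargement :: "'a metric \<Rightarrow> real \<Rightarrow> 'a set \<Rightarrow> 'a set" where
  "enlargement X e A = {x \<in> mspace X. \<exists>a\<in>A. mdist X a x < e}"

definition LP_bounds :: "'a metric \<Rightarrow> 'a pmf \<Rightarrow> 'a pmf \<Rightarrow> real set" where
  "LP_bounds X \<mu> \<nu> = {e. 0 < e \<and> (\<forall>A \<in> borel_sets_of X.
     measure_pmf.prob \<mu> A \<le> measure_pmf.prob \<nu> (enlargement X e A) + e \<and>
     measure_pmf.prob \<nu> A \<le> measure_pmf.prob \<mu> (enlargement X e A) + e)}"

definition LP_dist :: "'a metric \<Rightarrow> 'a pmf \<Rightarrow> 'a pmf \<Rightarrow> real" where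
  "LP_dist X \<mu> \<nu> = Inf (LP_bounds X \<mu> \<nu>)"

definition LP_metric :: "nat \<Rightarrow> 'a metric \<Rightarrow> 'a pmf metric" where
  "LP_metric n X = metric (fin_measures n (mspace X), LP_dist X)"

lemma LP_bounds_commute: "LP_bounds X \<mu> \<nu> = LP_bounds X \<nu> \<mu>"
  unfolding LP_bounds_def by blast

lemma LP_bounds_nonempty: "LP_bounds X \<mu> \<nu> \<noteq> {}"
proof -
  have "measure_pmf.prob p A \<le> measure_pmf.prob q B + 1" for p q :: "'a pmf" and A B
    by (smt (verit) measure_pmf.prob_le_1 measure_nonneg)
  then have "1 \<in> LP_bounds X \<mu> \<nu>"
    by (simp add: LP_bounds_def)
  then show ?thesis by blast
qed

lemma LP_bounds_bdd_below: "bdd_below (LP_bounds X \<mu> \<nu>)"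
  by (rule bdd_belowI[of _ 0]) (simp add: LP_bounds_def)

lemma LP_dist_nonneg: "0 \<le> LP_dist X \<mu> \<nu>"
  unfolding LP_dist_def
  by (rule cInf_greatest[OF LP_bounds_nonempty]) (simp add: LP_bounds_def)

lemma LP_dist_lessD:
  assumes "LP_dist X \<mu> \<nu> < e"
  obtains e' where "e' \<in> LP_bounds X \<mu> \<nu>" "0 < e'" "e' < e"
proof -
  obtain e' where "e' \<in> LP_bounds X \<mu> \<nu>" "e' < e"
    using cInf_lessD[OF LP_bounds_nonempty] assms unfolding LP_dist_def by blast
  moreover from this have "0 < e'" by (simp add: LP_bounds_def)
  ultimately show ?thesis using that by blast
qed

lemma borel_sets_of_subset:
  assumes "A \<in> borel_sets_of X"
  shows "A \<subseteq> mspace X"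
proof -
  have "{U. openin (mtopology_of X) U} \<subseteq> Pow (mspace X)"
    using openin_subset[of "mtopology_of X"] by simp blast
  then show ?thesis
    using sigma_sets_into_sp assms unfolding borel_sets_of_def by blast
qed

lemma enlargement_borel:
  assumes "A \<subseteq> mspace X"
  shows "enlargement X e A \<in> borel_sets_of X"
proof -
  interpret Metric_space "mspace X" "mdist X" by simp
  have "enlargement X e A = (\<Union>a\<in>A. mball a e)"
    using assms by (auto simp: enlargement_def mball_def)
  then have "openin (mtopology_of X) (enlargement X e A)"
    by (auto simp: mtopology_of_def)
  then show ?thesis
    by (simp add: borel_sets_of_def sigma_sets.Basic)
qed

lemma singleton_borel:
  assumes "x \<in> mspace X"
  shows "{x} \<in> borel_sets_of X"
proof -
  interpret Metric_space "mspace X" "mdist X" by simp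
  have "closedin (mtopology_of X) {x}"
    using assms closedin_Hausdorff_singleton[OF Hausdorff_space_mtopology]
    by (simp add: mtopology_of_def)
  then have "openin (mtopology_of X) (mspace X - {x})"
    by (simp add: closedin_def)
  then have "mspace X - (mspace X - {x}) \<in> borel_sets_of X"
    unfolding borel_sets_of_def by (simp add: sigma_sets.Basic sigma_sets.Compl)
  moreover have "mspace X - (mspace X - {x}) = {x}"
    using assms by blast
  ultimately show ?thesis by simp
qed

lemma LP_bounds_add:
  assumes "e1 \<in> LP_bounds X \<mu> \<nu>" "e2 \<in> LP_bounds X \<nu> \<rho>"
  shows "e1 + e2 \<in> LP_bounds X \<mu> \<rho>"
proof -
  have sub: "enlargement X a (enlargement X b A) \<subseteq> enlargement X (b + a) A"
    if "A \<subseteq> mspace X" for a b A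
  proof
    fix x assume "x \<in> enlargement X a (enlargement X b A)"
    then obtain y z where "x \<in> mspace X" "y \<in> mspace X" "z \<in> A" "mdist X y x < a" "mdist X z y < b"
      by (auto simp: enlargement_def)
    moreover from this have "mdist X z x \<le> mdist X z y + mdist X y x"
      using that by (intro mdist_triangle) auto
    ultimately have "mdist X z x < b + a" by linarith
    then show "x \<in> enlargement X (b + a) A"
      using \<open>x \<in> mspace X\<close> \<open>z \<in> A\<close> unfolding enlargement_def by blast
  qed
  have mono: "measure_pmf.prob p (enlargement X a (enlargement X b A))
      \<le> measure_pmf.prob p (enlargement X (b + a) A)"
    if "A \<subseteq> mspace X" for p :: "'a pmf" and a b A
    using sub[OF that] by (intro measure_pmf.finite_measure_mono) auto
  have "measure_pmf.prob \<mu> A \<le> measure_pmf.prob \<rho> (enlargement X (e1 + e2) A) + (e1 + e2) \<and>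
        measure_pmf.prob \<rho> A \<le> measure_pmf.prob \<mu> (enlargement X (e1 + e2) A) + (e1 + e2)"
    if A: "A \<in> borel_sets_of X" for A
  proof -
    note As = borel_sets_of_subset[OF A]
    have 1: "measure_pmf.prob \<mu> A \<le> measure_pmf.prob \<nu> (enlargement X e1 A) + e1"
            "measure_pmf.prob \<nu> (enlargement X e2 A)
               \<le> measure_pmf.prob \<mu> (enlargement X e1 (enlargement X e2 A)) + e1"
      using assms(1) A enlargement_borel[OF As] by (auto simp: LP_bounds_def)
    have 2: "measure_pmf.prob \<rho> A \<le> measure_pmf.prob \<nu> (enlargement X e2 A) + e2"
            "measure_pmf.prob \<nu> (enlargement X e1 A)
               \<le> measure_pmf.prob \<rho> (enlargement X e2 (enlargement X e1 A)) + e2"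
      using assms(2) A enlargement_borel[OF As] by (auto simp: LP_bounds_def)
    show ?thesis
      using 1 2 mono[OF As, of \<rho> e2 e1] mono[OF As, of \<mu> e1 e2]
      by (simp add: add.commute)
  qed
  then show ?thesis
    using assms by (auto simp: LP_bounds_def)
qed

lemma LP_dist_triangle: "LP_dist X \<mu> \<rho> \<le> LP_dist X \<mu> \<nu> + LP_dist X \<nu> \<rho>"
proof (rule field_le_epsilon)
  fix e :: real assume "0 < e"
  then obtain a b where "a \<in> LP_bounds X \<mu> \<nu>" "a < LP_dist X \<mu> \<nu> + e / 2"
      "b \<in> LP_bounds X \<nu> \<rho>" "b < LP_dist X \<nu> \<rho> + e / 2"
    by (metis LP_dist_lessD half_gt_zero less_add_same_cancel1)
  moreover from this have "LP_dist X \<mu> \<rho> \<le> a + b"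
    unfolding LP_dist_def[of X \<mu> \<rho>]
    by (intro cInf_lower LP_bounds_add LP_bounds_bdd_below)
  ultimately show "LP_dist X \<mu> \<rho> \<le> LP_dist X \<mu> \<nu> + LP_dist X \<nu> \<rho> + e"
    by simp
qed

lemma LP_dist_refl:
  assumes "set_pmf \<mu> \<subseteq> mspace X"
  shows "LP_dist X \<mu> \<mu> = 0"
proof -
  have "e \<in> LP_bounds X \<mu> \<mu>" if "0 < e" for e
  proof -
    have "measure_pmf.prob \<mu> A \<le> measure_pmf.prob \<mu> (enlargement X e A) + e"
      if A: "A \<in> borel_sets_of X" for A
    proof -
      have "A \<subseteq> enlargement X e A"
      proof
        fix x assume "x \<in> A"
        moreover from this have "x \<in> mspace X"
          using borel_sets_of_subset[OF A] by blast
        moreover from this have "mdist X x x < e"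
          using \<open>0 < e\<close> mdist_zero[of x X x] by (metis)
        ultimately show "x \<in> enlargement X e A"
          unfolding enlargement_def by blast
      qed
      then have "measure_pmf.prob \<mu> A \<le> measure_pmf.prob \<mu> (enlargement X e A)"
        by (intro measure_pmf.finite_measure_mono) auto
      then show ?thesis using \<open>0 < e\<close> by simp
    qed
    then show ?thesis using that by (simp add: LP_bounds_def)
  qed
  then have "LP_dist X \<mu> \<mu> \<le> 0 + e" if "0 < e" for e
    unfolding LP_dist_def using that
    by (simp add: cInf_lower LP_bounds_bdd_below)
  then have "LP_dist X \<mu> \<mu> \<le> 0" by (rule field_le_epsilon)
  then show ?thesis using LP_dist_nonneg[of X \<mu> \<mu>] by simp
qed

lemma LP_dist_zero_imp_le:
  assumes "LP_dist X \<mu> \<nu> = 0" "finite (set_pmf \<nu>)" "set_pmf \<nu> \<subseteq> mspace X" "x \<in> mspace X"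
  shows "pmf \<mu> x \<le> pmf \<nu> x"
proof (rule field_le_epsilon)
  fix e :: real assume "0 < e"
  define D where "D = insert e (mdist X x ` (set_pmf \<nu> - {x}))"
  have D: "finite D" "D \<noteq> {}" using assms(2) by (auto simp: D_def)
  have "0 < d" if "d \<in> D" for d
  proof (cases "d = e")
    case False
    then obtain y where "y \<in> set_pmf \<nu>" "y \<noteq> x" "d = mdist X x y"
      using \<open>d \<in> D\<close> by (auto simp: D_def)
    then show ?thesis
      using assms(3,4) by (metis less_eq_real_def mdist_nonneg mdist_zero subsetD)
  qed (use \<open>0 < e\<close> in simp)
  then have "0 < Min D" using D by simp
  then obtain r where r: "r \<in> LP_bounds X \<mu> \<nu>" "0 < r" "r < Min D"
    using LP_dist_lessD assms(1) by metis
  have "r < e" using r(3) D by (simp add: D_def)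
  have "y = x" if "y \<in> enlargement X r {x}" "y \<in> set_pmf \<nu>" for y
  proof (rule ccontr)
    assume "y \<noteq> x"
    then have "Min D \<le> mdist X x y"
      using D(1) that(2) by (intro Min_le) (auto simp: D_def)
    then show False using that(1) r(3) by (auto simp: enlargement_def)
  qed
  then have "measure_pmf.prob \<nu> (enlargement X r {x} \<inter> set_pmf \<nu>) \<le> measure_pmf.prob \<nu> {x}"
    by (intro measure_pmf.finite_measure_mono) auto
  then have "measure_pmf.prob \<nu> (enlargement X r {x}) \<le> pmf \<nu> x"
    by (simp add: measure_Int_set_pmf pmf.rep_eq)
  moreover have "pmf \<mu> x \<le> measure_pmf.prob \<nu> (enlargement X r {x}) + r"
    using r(1) singleton_borel[OF assms(4)] by (auto simp: LP_bounds_def pmf.rep_eq)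
  ultimately show "pmf \<mu> x \<le> pmf \<nu> x + e" using \<open>r < e\<close> by simp
qed

lemma Metric_space_LP_dist: "Metric_space (fin_measures n (mspace X)) (LP_dist X)"
proof
  show "0 \<le> LP_dist X \<mu> \<nu>" for \<mu> \<nu> by (rule LP_dist_nonneg)
  show comm: "LP_dist X \<mu> \<nu> = LP_dist X \<nu> \<mu>" for \<mu> \<nu>
    by (simp add: LP_dist_def LP_bounds_commute)
  show "LP_dist X \<mu> \<rho> \<le> LP_dist X \<mu> \<nu> + LP_dist X \<nu> \<rho>" for \<mu> \<nu> \<rho>
    by (rule LP_dist_triangle)
  fix \<mu> \<nu> assume \<mu>: "\<mu> \<in> fin_measures n (mspace X)" and \<nu>: "\<nu> \<in> fin_measures n (mspace X)"
  show "LP_dist X \<mu> \<nu> = 0 \<longleftrightarrow> \<mu> = \<nu>"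
  proof
    assume 0: "LP_dist X \<mu> \<nu> = 0"
    show "\<mu> = \<nu>"
    proof (rule pmf_eqI)
      fix x
      show "pmf \<mu> x = pmf \<nu> x"
      proof (cases "x \<in> mspace X")
        case True
        then show ?thesis
          using 0 comm[of \<mu> \<nu>] \<mu> \<nu>
          by (intro antisym LP_dist_zero_imp_le[of X]) (auto simp: fin_measures_def)
      next
        case False
        then have "x \<notin> set_pmf \<mu>" "x \<notin> set_pmf \<nu>"
          using \<mu> \<nu> by (auto simp: fin_measures_def)
        then show ?thesis by (simp add: set_pmf_iff)
      qed
    qed
  next
    assume "\<mu> = \<nu>"
    then show "LP_dist X \<mu> \<nu> = 0"
      using \<mu> by (simp add: LP_dist_refl fin_measures_def)
  qed
qed

lemma mspace_LP_metric [simp]: "mspace (LP_metric n X) = fin_measures n (mspace X)"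
  by (simp add: LP_metric_def Metric_space.mspace_metric[OF Metric_space_LP_dist])

lemma mdist_LP_metric [simp]: "mdist (LP_metric n X) = LP_dist X"
  by (simp add: LP_metric_def Metric_space.mdist_metric[OF Metric_space_LP_dist])


section \<open>Resolvable paths\<close>

definition resolver_map :: "(real \<Rightarrow> 'a) pmf \<Rightarrow> real \<Rightarrow> 'a pmf" where
  "resolver_map \<mu> = (\<lambda>t\<in>{0..1}. map_pmf (\<lambda>\<alpha>. \<alpha> t) \<mu>)"

definition resolvable :: "nat \<Rightarrow> 'a metric \<Rightarrow> (real \<Rightarrow> 'a pmf) \<Rightarrow> bool" where
  "resolvable n X f \<longleftrightarrow>
     (\<exists>\<mu> \<in> fin_measures n (topspace (path_space (mtopology_of X))). f = resolver_map \<mu>)"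

definition RP :: "nat \<Rightarrow> 'a metric \<Rightarrow> (real \<Rightarrow> 'a pmf) topology" where
  "RP n X = subtopology (path_space (mtopology_of (LP_metric n X))) {f. resolvable n X f}"


section \<open>Sequential intertwining topological complexity\<close>

definition iTC :: "nat \<Rightarrow> 'a metric \<Rightarrow> enat" where
  "iTC m X = Inf {enat n |n. \<exists>s.
     continuous_map (product_topology (\<lambda>i. mtopology_of X) {1..m}) (RP (n + 1) X) s \<and>
     (\<forall>x \<in> {1..m} \<rightarrow>\<^sub>E mspace X. \<forall>i \<in> {1..m}.
        s x ((real i - 1) / (real m - 1)) = return_pmf (x i))}"

end

theory Submission
  imports Defs
begin

text \<open>
  Let \<open>f: X \<rightarrow> Y\<close> and \<open>g: Y \<rightarrow> X\<close> be maps with a homotopy \<open>h\<close> from the identity of \<open>Y\<close> to \<open>f \<circ> g\<close>,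
  and let \<open>s\<close> witness \<open>iTC m X \<le> n\<close>. Pushing the path \<open>s (g y\<^sub>1, \<dots>, g y\<^sub>m)\<close> forward along \<open>f\<close>
  gives a resolvable path in the measures on \<open>Y\<close> that at the \<open>i\<close>-th prescribed time is the
  Dirac measure at \<open>f (g y\<^sub>i)\<close>, not at \<open>y\<^sub>i\<close>. This is repaired by stopping the path around that time
  and inserting a detour of Dirac measures: from \<open>f (g y\<^sub>i)\<close> back along \<open>h\<close> to \<open>y\<^sub>i\<close>,
  which is reached exactly at the prescribed time, and along \<open>h\<close> to \<open>f (g y\<^sub>i)\<close> again. Hence
  \<open>iTC m Y \<le> iTC m X\<close>, and a homotopy equivalence gives both inequalities.

  Two things have to be checked. The repaired path must be resolvable with no more atoms: every
  path \<open>\<alpha>\<close> in the support of a resolving measure passes through \<open>g y\<^sub>i\<close> at the \<open>i\<close>-th time,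
  because a Dirac measure there leaves no other possibility, so the same detours can be inserted
  into \<open>f \<circ> \<alpha>\<close>, and the detoured paths with the old weights resolve the repaired path
  (\<open>resolvable_splice\<close>). The repaired path must also depend continuously on
  \<open>y\<close>: by the exponential law (\<open>continuous_map_curry\<close>, \<open>continuous_map_uncurry\<close>) this amounts to
  joint continuity in \<open>y\<close> and the time, which follows by pasting finitely many closed pieces
  (\<open>continuous_map_splice\<close>) once pushing forward and forming Dirac measures are
  known to be continuous for the Levy--Prokhorov metric (\<open>continuous_map_map_pmf\<close>,
  \<open>continuous_map_return_pmf\<close>).
\<close>

section \<open>The exponential law for path spaces\<close>

text \<open>
  A subbasic open set prescribes that a compact set \<open>K\<close> is mapped into \<open>U\<close>. By the tube lemma, if
  the slice over \<open>x\<close> satisfies this condition, so do all slices over a neighbourhood of \<open>x\<close>.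
\<close>

lemma continuous_map_curry:
  assumes "continuous_map (prod_topology T A) Z (\<lambda>(x, t). F x t)"
  shows "continuous_map T (compact_open_topology A Z) (\<lambda>x. restrict (F x) (topspace A))"
  unfolding compact_open_topology_def
proof (rule continuous_on_generated_topo)
  have maps: "restrict (F x) (topspace A) \<in> continuous_maps A Z" if "x \<in> topspace T" for x
  proof -
    have "continuous_map A (prod_topology T A) (\<lambda>t. (x, t))"
      using that by (intro continuous_map_pairedI) auto
    from continuous_map_compose[OF this assms] have "continuous_map A Z (F x)"
      by (simp add: o_def)
    then have "continuous_map A Z (restrict (F x) (topspace A))"
      by (rule continuous_map_eq) auto
    then show ?thesis by (simp add: continuous_maps_def)
  qed
  have "continuous_maps A Z
      \<in> {{f \<in> continuous_maps A Z. f ` K \<subseteq> U} |K U. compactin A K \<and> openin Z U}"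
    by (rule CollectI, rule exI[of _ "{}"], rule exI[of _ "topspace Z"]) simp
  then show "(\<lambda>x. restrict (F x) (topspace A)) ` topspace T
      \<subseteq> \<Union> {{f \<in> continuous_maps A Z. f ` K \<subseteq> U} |K U. compactin A K \<and> openin Z U}"
    using maps by blast
  fix S assume "S \<in> {{f \<in> continuous_maps A Z. f ` K \<subseteq> U} |K U. compactin A K \<and> openin Z U}"
  then obtain K U where S: "S = {f \<in> continuous_maps A Z. f ` K \<subseteq> U}"
    and K: "compactin A K" and U: "openin Z U" by blast
  have KA: "K \<subseteq> topspace A" using K by (rule compactin_subset_topspace)
  define W where "W = {p \<in> topspace (prod_topology T A). (\<lambda>(x, t). F x t) p \<in> U}"
  have W: "openin (prod_topology T A) W"
    unfolding W_def by (rule openin_continuous_map_preimage[OF assms U])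
  have pre: "(\<lambda>x. restrict (F x) (topspace A)) -` S \<inter> topspace T
      = {x \<in> topspace T. {x} \<times> K \<subseteq> W}"
    using maps KA by (auto simp: S W_def image_subset_iff)
  show "openin T ((\<lambda>x. restrict (F x) (topspace A)) -` S \<inter> topspace T)"
    unfolding pre
  proof (subst openin_subopen, intro ballI)
    fix x assume "x \<in> {x \<in> topspace T. {x} \<times> K \<subseteq> W}"
    then obtain V V' where V: "openin T V" "x \<in> V" "K \<subseteq> V'" "V \<times> V' \<subseteq> W"
      using tube_lemma_right[OF W K, of x] by blast
    then have "V \<subseteq> {x \<in> topspace T. {x} \<times> K \<subseteq> W}"
      using openin_subset by blast
    then show "\<exists>V. openin T V \<and> x \<in> V \<and> V \<subseteq> {x \<in> topspace T. {x} \<times> K \<subseteq> W}"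
      using V by blast
  qed
qed

text \<open>
  Compact neighbourhoods in \<open>A\<close> turn continuity of a single map \<open>s x\<close> at \<open>t\<close> into a condition of the form
  "\<open>K\<close> is mapped into \<open>U\<close>", which persists for nearby points \<open>x\<close>.
\<close>

lemma continuous_map_uncurry:
  assumes A: "neighbourhood_base_of (compactin A) A"
    and s: "continuous_map T (compact_open_topology A Z) s"
  shows "continuous_map (prod_topology T A) Z (\<lambda>(x, t). s x t)"
  unfolding continuous_map_eq_topcontinuous_at topcontinuous_at_def
proof (intro ballI conjI allI impI)
  have sx: "continuous_map A Z (s x)" "s x \<in> continuous_maps A Z" if "x \<in> topspace T" for x
    using continuous_map_image_subset_topspace[OF s] that
    by (auto simp: continuous_maps_def)
  then show "(\<lambda>(x, t). s x t) \<in> topspace (prod_topology T A) \<rightarrow> topspace Z"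
    by (auto simp: continuous_map_def)
  fix p assume p: "p \<in> topspace (prod_topology T A)"
  then show "p \<in> topspace (prod_topology T A)" .
  obtain x t where xt: "p = (x, t)" "x \<in> topspace T" "t \<in> topspace A" using p by auto
  note cs = sx(1)[OF xt(2)]
  fix U assume U: "openin Z U \<and> (case p of (x, t) \<Rightarrow> s x t) \<in> U"
  then have "openin A {t \<in> topspace A. s x t \<in> U}" "t \<in> {t \<in> topspace A. s x t \<in> U}"
    using openin_continuous_map_preimage[OF cs] xt by auto
  then obtain V K where V: "openin A V" "compactin A K" "t \<in> V" "V \<subseteq> K"
      "K \<subseteq> {t \<in> topspace A. s x t \<in> U}"
    using A[unfolded neighbourhood_base_of, rule_format, of "{t \<in> topspace A. s x t \<in> U}" t]
    by blast
  define S where "S = {f \<in> continuous_maps A Z. f ` K \<subseteq> U}"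
  have "openin (compact_open_topology A Z) S"
    unfolding compact_open_topology_def S_def
    using V U by (intro topology_generated_by_Basis) blast
  then have W: "openin T {x \<in> topspace T. s x \<in> S}"
    by (rule openin_continuous_map_preimage[OF s])
  show "\<exists>W. openin (prod_topology T A) W \<and> p \<in> W \<and> (\<forall>y\<in>W. (case y of (x, t) \<Rightarrow> s x t) \<in> U)"
  proof (intro exI conjI)
    show "openin (prod_topology T A) ({x \<in> topspace T. s x \<in> S} \<times> V)"
      using W V by (simp add: openin_prod_Times_iff)
    show "p \<in> {x \<in> topspace T. s x \<in> S} \<times> V"
      using xt V sx by (auto simp: S_def)
    show "\<forall>y\<in>{x \<in> topspace T. s x \<in> S} \<times> V. (case y of (x, t) \<Rightarrow> s x t) \<in> U"
      using V by (auto simp: S_def)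
  qed
qed

lemma neighbourhood_base_unit_interval: "neighbourhood_base_of (compactin unit_interval) unit_interval"
proof -
  have "compact_space unit_interval" by (simp add: compact_space_subtopology)
  moreover have "Hausdorff_space unit_interval" by (simp add: Hausdorff_space_subtopology)
  ultimately show ?thesis
    using compact_imp_locally_compact_space locally_compact_space_neighbourhood_base by blast
qed

lemma continuous_map_reparametrize:
  fixes h :: "real \<Rightarrow> real"
  assumes F: "continuous_map (prod_topology T unit_interval) Z (\<lambda>(x, t). F x t)"
    and h: "continuous_on {0..1} h" "h ` {0..1} \<subseteq> {0..1}"
  shows "continuous_map (prod_topology T unit_interval) Z (\<lambda>(x, t). F x (h t))"
proof -
  have "continuous_map unit_interval unit_interval h"
    using h by (simp add: continuous_map_in_subtopology image_subset_iff_funcset)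
  then have "continuous_map (prod_topology T unit_interval) unit_interval (h \<circ> snd)"
    using continuous_map_snd continuous_map_compose by blast
  then have "continuous_map (prod_topology T unit_interval) (prod_topology T unit_interval)
      (\<lambda>p. (fst p, (h \<circ> snd) p))"
    by (intro continuous_map_pairedI continuous_map_fst)
  from continuous_map_compose[OF this F] show ?thesis
    by (simp add: o_def case_prod_unfold)
qed

section \<open>Splicing detours into a path\<close>

definition node :: "nat \<Rightarrow> nat \<Rightarrow> real" where
  "node m i = (real i - 1) / (real m - 1)"

text \<open>
  In the rescaled time \<open>\<tau> = t (m - 1)\<close> the nodes are the integers \<open>0, \<dots>, m - 1\<close>. In this scale the
  staircase is the piecewise linear map that is constantly \<open>k\<close> within distance \<open>1/4\<close> of an integer
  \<open>k\<close> and has slope \<open>2\<close> in between. The \<open>j\<close>-th summand is the rise from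
  \<open>j\<close> to \<open>j + 1\<close>; writing the map as a sum makes its continuity evident.
\<close>

definition staircase :: "nat \<Rightarrow> real \<Rightarrow> real" where
  "staircase m t =
     (\<Sum>j<m - 1. max 0 (min 1 (2 * (t * (real m - 1) - real j) - 1 / 2))) / (real m - 1)"

text \<open>
  The path \<open>e\<close> is run along the staircase, so that it waits while the rescaled time is within
  distance \<open>1/4\<close> of a node. During the wait at the node \<open>i\<close> the detour \<open>D i\<close> is run from its end to
  its beginning, which is reached exactly at the node, and then forwards again. Rounding
  \<open>\<tau>\<close> finds the nearest node, whose index is one more since nodes are counted from 1.
\<close>

definition splice :: "nat \<Rightarrow> (nat \<Rightarrow> real \<Rightarrow> 'z) \<Rightarrow> (real \<Rightarrow> 'z) \<Rightarrow> real \<Rightarrow> 'z" where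
  "splice m D e t =
     (let \<tau> = t * (real m - 1); k = round \<tau>
      in if \<bar>\<tau> - of_int k\<bar> \<le> 1 / 4 then D (nat k + 1) (4 * \<bar>\<tau> - of_int k\<bar>)
         else e (staircase m t))"

lemma staircase_unit:
  assumes "m \<ge> 2"
  shows "staircase m t \<in> {0..1}"
proof -
  have "(\<Sum>j<m - 1. max 0 (min 1 (2 * (t * (real m - 1) - real j) - 1 / 2))) \<le> (\<Sum>j<m - 1. 1)"
    by (rule sum_mono) auto
  moreover have "0 \<le> (\<Sum>j<m - 1. max 0 (min 1 (2 * (t * (real m - 1) - real j) - 1 / 2)))"
    by (rule sum_nonneg) auto
  ultimately show ?thesis
    using assms by (simp add: staircase_def field_simps of_nat_diff)
qed

lemma staircase_near_node:
  assumes "i \<in> {1..m}" and near: "\<bar>t * (real m - 1) - (real i - 1)\<bar> \<le> 1 / 4"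
  shows "staircase m t = node m i"
proof -
  have "max 0 (min 1 (2 * (\<tau> - real j) - 1 / 2)) = (if j < i - 1 then 1 else 0)"
    if near: "\<bar>\<tau> - (real i - 1)\<bar> \<le> 1 / 4" for j \<tau>
  proof (cases "j < i - 1")
    case True
    then have "real j + 1 \<le> real i - 1" by linarith
    then have "3 / 4 \<le> \<tau> - real j" using near by linarith
    then have "1 \<le> 2 * (\<tau> - real j) - 1 / 2" by (simp add: field_simps)
    then show ?thesis using True by simp
  next
    case False
    then have "real i - 1 \<le> real j" by linarith
    then have "\<tau> - real j \<le> 1 / 4" using near by linarith
    then have "2 * (\<tau> - real j) - 1 / 2 \<le> 0" by (simp add: field_simps)
    then show ?thesis using False by simp
  qed
  note this[OF near]
  then have "(\<Sum>j<m - 1. max 0 (min 1 (2 * (t * (real m - 1) - real j) - 1 / 2)))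
      = (\<Sum>j<m - 1. if j < i - 1 then 1 else 0)" by simp
  also have "\<dots> = real (card ({..<m - 1} \<inter> {j. j < i - 1}))"
    by (simp add: sum.If_cases)
  also have "{..<m - 1} \<inter> {j. j < i - 1} = {..<i - 1}" using assms(1) by auto
  finally show ?thesis using assms(1) by (simp add: staircase_def node_def of_nat_diff)
qed

lemma splice_near_node:
  assumes "1 \<le> i" and near: "\<bar>t * (real m - 1) - (real i - 1)\<bar> \<le> 1 / 4"
  shows "splice m D e t = D i (4 * \<bar>t * (real m - 1) - (real i - 1)\<bar>)"
proof -
  have "round (t * (real m - 1)) = int i - 1"
    using near by (intro round_unique') auto
  then show ?thesis using assms by (simp add: splice_def nat_diff_distrib')
qed

lemma splice_away_from_nodes:
  assumes "m \<ge> 2" "t \<in> {0..1}"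
    and far: "\<And>i. i \<in> {1..m} \<Longrightarrow> \<bar>t * (real m - 1) - (real i - 1)\<bar> > 1 / 4"
  shows "splice m D e t = e (staircase m t)"
proof -
  define \<tau> where "\<tau> = t * (real m - 1)"
  have \<tau>: "0 \<le> \<tau>" "\<tau> \<le> real m - 1"
    using assms(1,2) by (auto simp: \<tau>_def mult_left_le_one_le)
  have "round \<tau> \<ge> 0" using round_mono[OF \<tau>(1)] by simp
  moreover have "round (real m - 1) = int m - 1"
    by (rule round_unique') simp
  with round_mono[OF \<tau>(2)] have "round \<tau> \<le> int m - 1" by simp
  ultimately have "nat (round \<tau>) + 1 \<in> {1..m}" by auto
  from far[OF this] have "\<bar>\<tau> - of_int (round \<tau>)\<bar> > 1 / 4"
    using \<open>round \<tau> \<ge> 0\<close> by (simp add: \<tau>_def)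
  then show ?thesis by (simp add: splice_def Let_def \<tau>_def)
qed

lemma splice_node:
  assumes "m \<ge> 2" "1 \<le> i"
  shows "splice m D e (node m i) = D i 0"
  using assms by (subst splice_near_node[of i]) (auto simp: node_def)

text \<open>
  Stated for families over a parameter space, this serves both for the motion planner,
  with the parameter in the power of \<open>Y\<close>, and for a single path, with a one-point parameter space.
\<close>

lemma continuous_map_splice:
  assumes m: "m \<ge> 2"
    and E: "continuous_map (prod_topology T unit_interval) Z (\<lambda>(x, t). E x t)"
    and D: "\<And>i. i \<in> {1..m} \<Longrightarrow>
      continuous_map (prod_topology T unit_interval) Z (\<lambda>(x, u). D i x u)"
    and match: "\<And>i x. i \<in> {1..m} \<Longrightarrow> x \<in> topspace T \<Longrightarrow> D i x 1 = E x (node m i)"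
  shows "continuous_map (prod_topology T unit_interval) Z
           (\<lambda>(x, t). splice m (\<lambda>i. D i x) (E x) t)"
proof -
  let ?P = "prod_topology T unit_interval"
  define d where "d i t = \<bar>t * (real m - 1) - (real i - 1)\<bar>" for i and t :: real
  (* Piece i > 0 is the wait at the node i; piece 0 is the time spent moving along e. Truncating the
     detour parameter at 1 makes each formula in f continuous on the whole product. *)
  define C where "C i = (if i = 0 then topspace T \<times> ({0..1} \<inter> {t. \<forall>i\<in>{1..m}. 1 / 4 \<le> d i t})
      else topspace T \<times> ({0..1} \<inter> {t. d i t \<le> 1 / 4}))" for i :: nat
  define f where "f i = (if i = 0 then (\<lambda>(x, t). E x (staircase m t))
      else (\<lambda>(x, t). D i x (min 1 (4 * d i t))))" for i
  have d_cont: "continuous_on UNIV (d i)" for i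
    unfolding d_def by (intro continuous_intros)
  have unique: "i = j" if "d i t \<le> 1 / 4" "d j t \<le> 1 / 4" for i j t
  proof -
    have "\<bar>real i - real j\<bar> < 1" using that unfolding d_def by linarith
    then show ?thesis by linarith
  qed
  have near: "splice m D' e t = D' i (4 * d i t)" if "i \<in> {1..m}" "d i t \<le> 1 / 4"
    for D' e t i
    using that splice_near_node[of i t m D' e] by (simp add: d_def)
  show ?thesis
  proof (rule pasting_lemma_closed[of "{0..m}" ?P C Z f])
    show "finite {0..m}" by simp
  next
    fix i assume "i \<in> {0..m}"
    have "closed {t. d i t \<le> 1 / 4}"
      by (intro closed_Collect_le d_cont continuous_on_const)
    moreover have "closed {t. \<forall>i\<in>{1..m}. 1 / 4 \<le> d i t}"
      unfolding Collect_ball_eq by (intro closed_INT ballI closed_Collect_le d_cont continuous_on_const)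
    ultimately show "closedin ?P (C i)"
      by (auto simp: C_def closedin_prod_Times_iff intro: closedin_closed_Int)
  next
    fix i assume i: "i \<in> {0..m}"
    have "continuous_map ?P Z (f i)"
    proof (cases "i = 0")
      case True
      have "continuous_on {0..1} (staircase m)"
        unfolding staircase_def using m by (intro continuous_intros) auto
      then have "continuous_map ?P Z (\<lambda>(x, t). E x (staircase m t))"
        using staircase_unit[OF m] by (intro continuous_map_reparametrize[OF E]) auto
      then show ?thesis using True by (simp add: f_def)
    next
      case False
      then have "i \<in> {1..m}" using i by simp
      moreover have "continuous_on {0..1} (\<lambda>t. min 1 (4 * d i t))"
        by (intro continuous_intros continuous_on_subset[OF d_cont]) auto
      ultimately have "continuous_map ?P Z (\<lambda>(x, t). D i x (min 1 (4 * d i t)))"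
        by (intro continuous_map_reparametrize[OF D]) (auto simp: d_def)
      then show ?thesis using False by (simp add: f_def)
    qed
    then show "continuous_map (subtopology ?P (C i)) Z (f i)"
      by (rule continuous_map_from_subtopology)
  next
    have overlap: "f 0 p = f i p" if "i \<in> {1..m}" "p \<in> C 0" "p \<in> C i" for i p
    proof -
      obtain x t where p: "p = (x, t)" by (cases p)
      then have "x \<in> topspace T" "d i t = 1 / 4"
        using that by (auto simp: C_def intro: antisym)
      then have "staircase m t = node m i"
        using staircase_near_node[of i m t] that(1) by (simp add: d_def)
      then show ?thesis
        using p that(1) match \<open>x \<in> topspace T\<close> \<open>d i t = 1 / 4\<close> by (simp add: f_def)
    qed
    fix i j p assume ij: "i \<in> {0..m}" "j \<in> {0..m}" and p: "p \<in> topspace ?P \<inter> C i \<inter> C j"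
    consider "i = j" | "i = 0" "j \<in> {1..m}" | "j = 0" "i \<in> {1..m}" | "i \<in> {1..m}" "j \<in> {1..m}"
      using ij by fastforce
    then show "f i p = f j p"
    proof cases
      case 4
      then have "i = j" using p by (intro unique[of i "snd p" j]) (auto simp: C_def)
      then show ?thesis by simp
    qed (use overlap p in auto)
  next
    fix p assume "p \<in> topspace ?P"
    then obtain x t where p: "p = (x, t)" "x \<in> topspace T" "t \<in> {0..1}" by auto
    show "\<exists>j. j \<in> {0..m} \<and> p \<in> C j \<and> (\<lambda>(x, t). splice m (\<lambda>i. D i x) (E x) t) p = f j p"
    proof (cases "\<exists>i\<in>{1..m}. d i t \<le> 1 / 4")
      case True
      then obtain i where "i \<in> {1..m}" "d i t \<le> 1 / 4" by blast
      then show ?thesis using p near[of i t]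
        by (intro exI[of _ i]) (auto simp: C_def f_def)
    next
      case False
      then have "splice m (\<lambda>i. D i x) (E x) t = E x (staircase m t)"
        using p by (intro splice_away_from_nodes[OF m]) (auto simp: d_def not_le)
      then show ?thesis using p False
        by (intro exI[of _ 0]) (auto simp: C_def f_def)
    qed
  qed
qed

section \<open>Functoriality of the Levy--Prokhorov spaces\<close>

lemma finite_borel:
  assumes "finite A" "A \<subseteq> mspace X"
  shows "A \<in> borel_sets_of X"
  using assms
proof (induction A rule: finite_induct)
  case empty
  then show ?case by (simp add: borel_sets_of_def sigma_sets.Empty)
next
  case (insert x A)
  then show ?case
    using sigma_sets_Un[of "{x}" "mspace X" _ A] singleton_borel[of x X]
    by (simp add: borel_sets_of_def)
qed

text \<open>
  A finitely supported measure only sees the points of its support, so the defining inequality of the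
  Levy--Prokhorov metric holds for arbitrary sets, Borel or not, and the enlargement may be taken
  of the part of the set that meets the support. This frees the estimates for
  push-forwards from questions of measurability.
\<close>

lemma LP_boundsD:
  assumes "e \<in> LP_bounds X \<mu> \<nu>" "finite (set_pmf \<mu>)" "set_pmf \<mu> \<subseteq> mspace X"
  shows "measure_pmf.prob \<mu> A \<le> measure_pmf.prob \<nu> (enlargement X e (A \<inter> set_pmf \<mu>)) + e"
proof -
  have "A \<inter> set_pmf \<mu> \<in> borel_sets_of X"
    using assms by (intro finite_borel) auto
  then have "measure_pmf.prob \<mu> (A \<inter> set_pmf \<mu>)
      \<le> measure_pmf.prob \<nu> (enlargement X e (A \<inter> set_pmf \<mu>)) + e"
    using assms(1) by (simp add: LP_bounds_def)
  then show ?thesis by (simp add: measure_Int_set_pmf)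
qed

lemma LP_dist_le:
  assumes "e \<in> LP_bounds X \<mu> \<nu>"
  shows "LP_dist X \<mu> \<nu> \<le> e"
  unfolding LP_dist_def using assms by (intro cInf_lower LP_bounds_bdd_below)

text \<open>
  Continuity at \<open>\<mu>\<close> only involves the modulus of continuity of \<open>f\<close> at the points of the support \<open>S\<close>
  of \<open>\<mu>\<close>, and since \<open>S\<close> is finite, one \<open>\<delta>\<close> serves for all of them. A measure \<open>\<nu>\<close> that is \<open>r\<close>-close to \<open>\<mu>\<close> has all but mass \<open>r\<close> in the
  \<open>r\<close>-neighbourhood \<open>N\<close> of \<open>S\<close>. Within \<open>N\<close> only pairs with one point in \<open>S\<close> have to be
  compared; the mass outside costs another \<open>r\<close>.
\<close>

lemma continuous_map_map_pmf:
  assumes f: "continuous_map (mtopology_of X) (mtopology_of Y) f"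
  shows "continuous_map (mtopology_of (LP_metric n X)) (mtopology_of (LP_metric n Y)) (map_pmf f)"
proof -
  interpret LX: Metric_space "fin_measures n (mspace X)" "LP_dist X" by (rule Metric_space_LP_dist)
  have LY: "Metric_space (fin_measures n (mspace Y)) (LP_dist Y)" by (rule Metric_space_LP_dist)
  interpret X: Metric_space "mspace X" "mdist X" by simp
  have fXY: "f x \<in> mspace Y" if "x \<in> mspace X" for x
    using continuous_map_image_subset_topspace[OF f] that by auto
  have f_eps: "\<exists>\<delta>>0. \<forall>y. y \<in> mspace X \<and> mdist X x y < \<delta> \<longrightarrow> mdist Y (f x) (f y) < \<epsilon>"
    if "x \<in> mspace X" "\<epsilon> > 0" for x \<epsilon>
    using f that X.metric_continuous_map[OF Metric_space_mspace_mdist[of Y], of f]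
    by (auto simp: mtopology_of_def)
  have maps: "map_pmf f \<mu> \<in> fin_measures n (mspace Y)" if "\<mu> \<in> fin_measures n (mspace X)" for \<mu>
  proof -
    have "card (f ` set_pmf \<mu>) \<le> card (set_pmf \<mu>)"
      using that by (intro card_image_le) (auto simp: fin_measures_def)
    then show ?thesis using that fXY by (auto simp: fin_measures_def)
  qed
  have "\<exists>\<delta>>0. \<forall>\<nu>. \<nu> \<in> fin_measures n (mspace X) \<and> LP_dist X \<mu> \<nu> < \<delta>
        \<longrightarrow> LP_dist Y (map_pmf f \<mu>) (map_pmf f \<nu>) < \<epsilon>"
    if \<mu>: "\<mu> \<in> fin_measures n (mspace X)" and \<epsilon>: "\<epsilon> > 0" for \<mu> \<epsilon>
  proof -
    define S where "S = set_pmf \<mu>"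
    have S: "finite S" "S \<subseteq> mspace X" using \<mu> by (auto simp: S_def fin_measures_def)
    have "\<forall>x\<in>S. \<exists>\<delta>>0. \<forall>y. y \<in> mspace X \<and> mdist X x y < \<delta> \<longrightarrow> mdist Y (f x) (f y) < \<epsilon> / 2"
      using f_eps S \<epsilon> by (meson half_gt_zero subsetD)
    then obtain \<Delta> where \<Delta>: "\<And>x. x \<in> S \<Longrightarrow> \<Delta> x > 0"
      "\<And>x y. x \<in> S \<Longrightarrow> y \<in> mspace X \<Longrightarrow> mdist X x y < \<Delta> x \<Longrightarrow> mdist Y (f x) (f y) < \<epsilon> / 2"
      by metis
    (* The bound eps/4 pays for two errors r, and the target eps/2 leaves room for the strict inequality. *)
    define \<delta> where "\<delta> = Min (insert (\<epsilon> / 4) (\<Delta> ` S))"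
    have fin: "finite (insert (\<epsilon> / 4) (\<Delta> ` S))" using S(1) by simp
    have \<delta>: "\<delta> > 0" "\<delta> \<le> \<epsilon> / 4" "\<And>x. x \<in> S \<Longrightarrow> \<delta> \<le> \<Delta> x"
    proof -
      show "\<delta> > 0" using fin \<Delta>(1) \<epsilon> by (simp add: \<delta>_def Min_gr_iff)
      show "\<delta> \<le> \<epsilon> / 4" unfolding \<delta>_def by (rule Min_le[OF fin]) simp
      show "\<delta> \<le> \<Delta> x" if "x \<in> S" for x
        unfolding \<delta>_def using that by (intro Min_le[OF fin]) simp
    qed
    show ?thesis
    proof (intro exI[of _ \<delta>] conjI allI impI \<delta>(1))
      fix \<nu> assume \<nu>': "\<nu> \<in> fin_measures n (mspace X) \<and> LP_dist X \<mu> \<nu> < \<delta>"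
      then obtain r where r: "r \<in> LP_bounds X \<mu> \<nu>" "0 < r" "r < \<delta>"
        using LP_dist_lessD by metis
      have \<nu>: "finite (set_pmf \<nu>)" "set_pmf \<nu> \<subseteq> mspace X"
        using \<nu>' by (auto simp: fin_measures_def)
      have r': "r \<in> LP_bounds X \<nu> \<mu>" using r(1) by (simp add: LP_bounds_commute)
      have close: "mdist Y (f x) (f y) < \<epsilon> / 2" if "x \<in> S" "y \<in> mspace X" "mdist X x y < r" for x y
        using \<Delta>(2)[OF that(1,2)] that(3) r(3) \<delta>(3)[OF that(1)] by linarith
      have "measure_pmf.prob \<mu> (f -` A)
            \<le> measure_pmf.prob \<nu> (f -` enlargement Y (\<epsilon> / 2) A) + \<epsilon> / 2"
        and "measure_pmf.prob \<nu> (f -` A)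
            \<le> measure_pmf.prob \<mu> (f -` enlargement Y (\<epsilon> / 2) A) + \<epsilon> / 2" for A
      proof -
        have "enlargement X r (f -` A \<inter> S) \<subseteq> f -` enlargement Y (\<epsilon> / 2) A"
          using close fXY by (auto simp: enlargement_def)
        then have "measure_pmf.prob \<nu> (enlargement X r (f -` A \<inter> S))
            \<le> measure_pmf.prob \<nu> (f -` enlargement Y (\<epsilon> / 2) A)"
          by (intro measure_pmf.finite_measure_mono) auto
        then show "measure_pmf.prob \<mu> (f -` A)
            \<le> measure_pmf.prob \<nu> (f -` enlargement Y (\<epsilon> / 2) A) + \<epsilon> / 2"
          using LP_boundsD[OF r(1), of "f -` A"] S r \<delta> by (simp add: S_def)
        define N where "N = enlargement X r S"
        have "1 \<le> measure_pmf.prob \<nu> N + r"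
          using LP_boundsD[OF r(1), of UNIV] S by (simp add: S_def N_def)
        then have out: "measure_pmf.prob \<nu> (- N) \<le> r"
          using measure_pmf.prob_compl[of N \<nu>] by (simp add: Compl_eq_Diff_UNIV)
        have "measure_pmf.prob \<nu> (f -` A)
            \<le> measure_pmf.prob \<nu> (f -` A \<inter> N \<union> - N)"
          by (intro measure_pmf.finite_measure_mono) auto
        also have "\<dots> \<le> measure_pmf.prob \<nu> (f -` A \<inter> N) + measure_pmf.prob \<nu> (- N)"
          by (intro measure_Un_le) auto
        finally have 1: "measure_pmf.prob \<nu> (f -` A) \<le> measure_pmf.prob \<nu> (f -` A \<inter> N) + r"
          using out by simp
        have "enlargement X r (f -` A \<inter> N \<inter> set_pmf \<nu>) \<inter> S \<subseteq> f -` enlargement Y (\<epsilon> / 2) A"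
        proof
          fix x assume "x \<in> enlargement X r (f -` A \<inter> N \<inter> set_pmf \<nu>) \<inter> S"
          then obtain y where y: "f y \<in> A" "y \<in> mspace X" "mdist X y x < r" "x \<in> S" "x \<in> mspace X"
            using \<nu> by (auto simp: enlargement_def)
          then have "mdist Y (f y) (f x) < \<epsilon> / 2"
            using close[of x y] by (simp add: mdist_commute)
          then show "x \<in> f -` enlargement Y (\<epsilon> / 2) A"
            using y fXY by (auto simp: enlargement_def)
        qed
        then have "measure_pmf.prob \<mu> (enlargement X r (f -` A \<inter> N \<inter> set_pmf \<nu>) \<inter> S)
            \<le> measure_pmf.prob \<mu> (f -` enlargement Y (\<epsilon> / 2) A)"
          by (intro measure_pmf.finite_measure_mono) auto
        then have 2: "measure_pmf.prob \<mu> (enlargement X r (f -` A \<inter> N \<inter> set_pmf \<nu>))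
            \<le> measure_pmf.prob \<mu> (f -` enlargement Y (\<epsilon> / 2) A)"
          by (simp add: S_def measure_Int_set_pmf)
        show "measure_pmf.prob \<nu> (f -` A)
            \<le> measure_pmf.prob \<mu> (f -` enlargement Y (\<epsilon> / 2) A) + \<epsilon> / 2"
          using 1 2 LP_boundsD[OF r' \<nu>, of "f -` A \<inter> N"] r(3) \<delta>(2) by linarith
      qed
      then have "\<epsilon> / 2 \<in> LP_bounds Y (map_pmf f \<mu>) (map_pmf f \<nu>)"
        using \<epsilon> by (simp add: LP_bounds_def)
      from LP_dist_le[OF this] show "LP_dist Y (map_pmf f \<mu>) (map_pmf f \<nu>) < \<epsilon>"
        using \<epsilon> by simp
    qed
  qed
  then show ?thesis
    using maps LX.metric_continuous_map[OF LY, of "map_pmf f"]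
    by (auto simp: mtopology_of_def)
qed

lemma continuous_map_return_pmf:
  assumes "1 \<le> n"
  shows "continuous_map (mtopology_of X) (mtopology_of (LP_metric n X)) return_pmf"
proof -
  have LX: "Metric_space (fin_measures n (mspace X)) (LP_dist X)" by (rule Metric_space_LP_dist)
  interpret X: Metric_space "mspace X" "mdist X" by simp
  have "LP_dist X (return_pmf x) (return_pmf y) < e"
    if "x \<in> mspace X" "y \<in> mspace X" "e > 0" "mdist X x y < e / 2" for x y e
  proof -
    have "e / 2 \<in> LP_bounds X (return_pmf x) (return_pmf y)"
      using that by (auto simp: LP_bounds_def enlargement_def mdist_commute indicator_def)
    from LP_dist_le[OF this] show ?thesis using that by simp
  qed
  then have "\<exists>\<delta>>0. \<forall>y. y \<in> mspace X \<and> mdist X x y < \<delta>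
        \<longrightarrow> LP_dist X (return_pmf x) (return_pmf y) < e" if "x \<in> mspace X" "e > 0" for x e
    using that by (intro exI[of _ "e / 2"]) auto
  then show ?thesis
    using assms X.metric_continuous_map[OF LX, of return_pmf]
    by (auto simp: mtopology_of_def fin_measures_def)
qed


section \<open>Transfer along a homotopy domination\<close>

text \<open>
  Both sides choose between detour and path by looking at the time only. While waiting, the
  paths in the support of \<open>\<mu>\<close> all follow the same detour, which gives a Dirac measure.
\<close>

lemma map_pmf_splice:
  assumes "m \<ge> 2"
  shows "map_pmf (\<lambda>\<alpha>. splice m D (\<lambda>t. f (\<alpha> t)) t) \<mu>
    = splice m (\<lambda>i u. return_pmf (D i u)) (\<lambda>t. map_pmf f (resolver_map \<mu> t)) t"
  using staircase_unit[OF assms, of t]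
  by (simp add: splice_def Let_def map_pmf_const resolver_map_def map_pmf_comp)

lemma node_unit:
  assumes "m \<ge> 2" "i \<in> {1..m}"
  shows "node m i \<in> {0..1}"
  using assms by (auto simp: node_def)

text \<open>
  The detours have to be inserted into each path of a resolving measure separately, and
  they fit because the measure \<open>c\<close> takes at a node is a Dirac measure: all paths in the support
  of the resolving measure meet there. Mapping paths to detoured paths cannot enlarge
  the support, so \<open>n\<close> is kept.
\<close>

lemma resolvable_splice:
  assumes m: "m \<ge> 2"
    and f: "continuous_map (mtopology_of X) (mtopology_of Y) f"
    and D: "\<And>i. i \<in> {1..m} \<Longrightarrow> pathin (mtopology_of Y) (D i)"
    and c: "resolvable n X c"
    and nodes: "\<And>i. i \<in> {1..m} \<Longrightarrow> c (node m i) = return_pmf (x i)"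
    and match: "\<And>i. i \<in> {1..m} \<Longrightarrow> D i 1 = f (x i)"
  shows "resolvable n Y
    (\<lambda>t\<in>{0..1}. splice m (\<lambda>i u. return_pmf (D i u)) (\<lambda>t. map_pmf f (c t)) t)"
proof -
  obtain \<mu> where \<mu>: "\<mu> \<in> fin_measures n (topspace (path_space (mtopology_of X)))"
    and c_eq: "c = resolver_map \<mu>"
    using c by (auto simp: resolvable_def)
  define sp where "sp \<alpha> = (\<lambda>t\<in>{0..1}. splice m D (\<lambda>t. f (\<alpha> t)) t)" for \<alpha>
  have sp: "sp \<alpha> \<in> topspace (path_space (mtopology_of Y))" if \<alpha>: "\<alpha> \<in> set_pmf \<mu>" for \<alpha>
  proof -
    have path: "continuous_map unit_interval (mtopology_of X) \<alpha>"
      using \<alpha> \<mu> by (auto simp: fin_measures_def topspace_path_space pathin_def)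
    have at_node: "\<alpha> (node m i) = x i" if i: "i \<in> {1..m}" for i
    proof -
      have "map_pmf (\<lambda>\<alpha>. \<alpha> (node m i)) \<mu> = return_pmf (x i)"
        using nodes[OF i] node_unit[OF m i] by (simp add: c_eq resolver_map_def)
      then have "(\<lambda>\<alpha>. \<alpha> (node m i)) ` set_pmf \<mu> = {x i}"
        by (metis set_map_pmf set_return_pmf)
      then show ?thesis using \<alpha> by blast
    qed
    let ?P = "prod_topology (discrete_topology {()}) unit_interval"
    have const: "continuous_map ?P (mtopology_of Y) (\<lambda>(_, t). \<beta> t)"
      if "continuous_map unit_interval (mtopology_of Y) \<beta>" for \<beta>
      using continuous_map_compose[OF continuous_map_snd that]
      by (simp add: o_def case_prod_unfold)
    have f\<alpha>: "continuous_map unit_interval (mtopology_of Y) (\<lambda>t. f (\<alpha> t))"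
      using continuous_map_compose[OF path f] by (simp add: o_def)
    have "continuous_map ?P (mtopology_of Y) (\<lambda>(_, t). splice m D (\<lambda>t. f (\<alpha> t)) t)"
      using D at_node match
      by (intro continuous_map_splice[OF m, where D="\<lambda>i _. D i"] const f\<alpha>) (auto simp: pathin_def)
    from continuous_map_curry[OF this]
    have "continuous_map (discrete_topology {()}) (path_space (mtopology_of Y)) (\<lambda>_. sp \<alpha>)"
      by (simp add: path_space_def sp_def)
    from continuous_map_image_subset_topspace[OF this] show ?thesis by simp
  qed
  have "card (sp ` set_pmf \<mu>) \<le> card (set_pmf \<mu>)"
    using \<mu> by (intro card_image_le) (auto simp: fin_measures_def)
  then have "map_pmf sp \<mu> \<in> fin_measures n (topspace (path_space (mtopology_of Y)))"
    using \<mu> sp by (auto simp: fin_measures_def)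
  moreover have "(\<lambda>t\<in>{0..1}. splice m (\<lambda>i u. return_pmf (D i u)) (\<lambda>t. map_pmf f (c t)) t)
      = resolver_map (map_pmf sp \<mu>)"
    unfolding c_eq map_pmf_splice[OF m, symmetric]
    by (rule ext) (simp add: resolver_map_def map_pmf_comp sp_def)
  ultimately show ?thesis unfolding resolvable_def by blast
qed

text \<open>
  A homotopy \<open>f \<circ> g \<simeq> id\<close> on \<open>Y\<close> carries motion planners from \<open>X\<close> to \<open>Y\<close>: it provides the
  detours from \<open>y\<^sub>i\<close> to \<open>f (g y\<^sub>i)\<close>.
\<close>

lemma iTC_le_of_homotopy_domination:
  assumes m: "m \<ge> 2"
    and f: "continuous_map (mtopology_of X) (mtopology_of Y) f"
    and g: "continuous_map (mtopology_of Y) (mtopology_of X) g"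
    and fg: "homotopic_with (\<lambda>_. True) (mtopology_of Y) (mtopology_of Y) (f \<circ> g) id"
  shows "iTC m Y \<le> iTC m X"
proof -
  obtain h where h: "continuous_map (prod_topology unit_interval (mtopology_of Y)) (mtopology_of Y) h"
    and h0: "\<And>y. h (0, y) = y" and h1: "\<And>y. h (1, y) = f (g y)"
    using homotopic_with_symD[OF fg] by (auto simp: homotopic_with_def)
  let ?X = "product_topology (\<lambda>i. mtopology_of X) {1..m}"
  let ?Y = "product_topology (\<lambda>i. mtopology_of Y) {1..m}"
  have transfer: "\<exists>s'. continuous_map ?Y (RP (n + 1) Y) s' \<and>
      (\<forall>y \<in> {1..m} \<rightarrow>\<^sub>E mspace Y. \<forall>i \<in> {1..m}. s' y (node m i) = return_pmf (y i))"
    if s: "continuous_map ?X (RP (n + 1) X) s"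
      and s_node: "\<And>x i. x \<in> {1..m} \<rightarrow>\<^sub>E mspace X \<Longrightarrow> i \<in> {1..m} \<Longrightarrow>
        s x (node m i) = return_pmf (x i)" for n s
  proof -
    define G where "G y = (\<lambda>i\<in>{1..m}. g (y i))" for y :: "nat \<Rightarrow> 'b"
    define E where "E y t = map_pmf f (s (G y) t)" for y t
    define D where "D i y u = return_pmf (h (u, y i))" for i and y :: "nat \<Rightarrow> 'b" and u :: real
    define s' where "s' y = (\<lambda>t\<in>{0..1}. splice m (\<lambda>i. D i y) (E y) t)" for y
    have "continuous_map ?Y (mtopology_of X) (\<lambda>y. g (y i))" if "i \<in> {1..m}" for i
      using continuous_map_compose[OF continuous_map_product_projection[OF that] g]
      by (simp add: o_def)
    then have G: "continuous_map ?Y ?X G"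
      unfolding G_def by (subst continuous_map_componentwise) auto
    then have G_space: "G y \<in> {1..m} \<rightarrow>\<^sub>E mspace X" if "y \<in> topspace ?Y" for y
      using continuous_map_image_subset_topspace[OF G] that by auto
    have s_path: "continuous_map ?X (path_space (mtopology_of (LP_metric (n + 1) X))) s"
      and s_res: "\<And>x. x \<in> topspace ?X \<Longrightarrow> resolvable (n + 1) X (s x)"
      using s by (auto simp: RP_def continuous_map_in_subtopology)
    have "continuous_map (prod_topology ?Y unit_interval) (mtopology_of (LP_metric (n + 1) X))
        (\<lambda>(y, t). (s \<circ> G) y t)"
      using continuous_map_compose[OF G s_path] unfolding path_space_def
      by (rule continuous_map_uncurry[OF neighbourhood_base_unit_interval])
    from continuous_map_compose[OF this continuous_map_map_pmf[OF f]]
    have E: "continuous_map (prod_topology ?Y unit_interval) (mtopology_of (LP_metric (n + 1) Y))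
        (\<lambda>(y, t). E y t)"
      by (simp add: E_def o_def case_prod_unfold)
    have D: "continuous_map (prod_topology ?Y unit_interval) (mtopology_of (LP_metric (n + 1) Y))
        (\<lambda>(y, u). D i y u)" if "i \<in> {1..m}" for i
    proof -
      have "continuous_map (prod_topology ?Y unit_interval) (mtopology_of Y) ((\<lambda>y. y i) \<circ> fst)"
        by (rule continuous_map_compose[OF continuous_map_fst continuous_map_product_projection[OF that]])
      then have "continuous_map (prod_topology ?Y unit_interval)
          (prod_topology unit_interval (mtopology_of Y)) (\<lambda>p. (snd p, ((\<lambda>y. y i) \<circ> fst) p))"
        by (intro continuous_map_pairedI continuous_map_snd)
      from continuous_map_compose[OF continuous_map_compose[OF this h] continuous_map_return_pmf]
      show ?thesis by (simp add: D_def o_def case_prod_unfold)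
    qed
    (* At u = 1 the homotopy has reached f (g (y i)), where the pushed-forward path is at that node. *)
    have match: "D i y 1 = E y (node m i)" if "i \<in> {1..m}" "y \<in> topspace ?Y" for i y
      using that s_node[OF G_space that(1)] by (simp add: D_def E_def h1 G_def)
    have "s' = (\<lambda>y. restrict (splice m (\<lambda>i. D i y) (E y)) {0..1})"
      by (simp add: s'_def fun_eq_iff)
    then have "continuous_map ?Y (path_space (mtopology_of (LP_metric (n + 1) Y))) s'"
      using continuous_map_curry[OF continuous_map_splice[OF m E D match]]
      by (simp add: path_space_def)
    moreover have "resolvable (n + 1) Y (s' y)" if y: "y \<in> topspace ?Y" for y
    proof -
      have "pathin (mtopology_of Y) (\<lambda>u. h (u, y i))" if i: "i \<in> {1..m}" for i
      proof -
        have "continuous_map unit_interval (prod_topology unit_interval (mtopology_of Y)) (\<lambda>u. (u, y i))"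
          using y i by (intro continuous_map_pairedI) (auto simp: PiE_iff)
        from continuous_map_compose[OF this h] show ?thesis by (simp add: pathin_def o_def)
      qed
      moreover have "resolvable (n + 1) X (s (G y))"
        using s_res G_space[OF y] by simp
      ultimately show ?thesis
        unfolding s'_def D_def E_def
        using s_node[OF G_space[OF y]] h1
        by (intro resolvable_splice[OF m f]) (auto simp: G_def)
    qed
    ultimately have "continuous_map ?Y (RP (n + 1) Y) s'"
      by (auto simp: RP_def continuous_map_in_subtopology)
    moreover have "s' y (node m i) = return_pmf (y i)" if "i \<in> {1..m}" for y i
      using node_unit[OF m that] that m by (simp add: s'_def splice_node D_def h0)
    ultimately show ?thesis by blast
  qed
  show ?thesis
    unfolding iTC_def node_def[symmetric]
  proof (intro Inf_superset_mono Collect_mono impI; elim exE conjE)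
    fix k n s
    assume "k = enat n" and s: "continuous_map ?X (RP (n + 1) X) s"
      and s_node: "\<forall>x \<in> {1..m} \<rightarrow>\<^sub>E mspace X. \<forall>i \<in> {1..m}. s x (node m i) = return_pmf (x i)"
    then show "\<exists>n. k = enat n \<and> (\<exists>s. continuous_map ?Y (RP (n + 1) Y) s \<and>
        (\<forall>y \<in> {1..m} \<rightarrow>\<^sub>E mspace Y. \<forall>i \<in> {1..m}. s y (node m i) = return_pmf (y i)))"
      using transfer[OF s] by (intro exI[of _ n]) simp
  qed
qed

theorem corollary4p4:
  fixes X :: "'a metric" and Y :: "'b metric" and m :: nat
  assumes "m \<ge> 2"
    and "path_connected_space (mtopology_of X)" and "ANR_space (mtopology_of X)"
    and "path_connected_space (mtopology_of Y)" and "ANR_space (mtopology_of Y)"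
    and "mtopology_of X homotopy_equivalent_space mtopology_of Y"
  shows "iTC m X = iTC m Y"
proof -
  obtain f g where
    "continuous_map (mtopology_of X) (mtopology_of Y) f"
    "continuous_map (mtopology_of Y) (mtopology_of X) g"
    "homotopic_with (\<lambda>_. True) (mtopology_of X) (mtopology_of X) (g \<circ> f) id"
    "homotopic_with (\<lambda>_. True) (mtopology_of Y) (mtopology_of Y) (f \<circ> g) id"
    using assms(6) unfolding homotopy_equivalent_space_def by blast
  then show ?thesis
    by (intro antisym iTC_le_of_homotopy_domination[OF \<open>m \<ge> 2\<close>, of X Y f g]
        iTC_le_of_homotopy_domination[OF \<open>m \<ge> 2\<close>, of Y X g f])
qed

end
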